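(* There exists a covering system of the integers such that all moduli are odd, greater than $1$, and pairwise distinct, except that $7$ is used exactly four times as a modulus.
   Context: A covering system of the integers is a finite collection of congruences $x\equiv r_j \pmod{m_j}$ such that every integer satisfies at least one of them. "$7$ is used exactly four times as a modulus" means exactly four congruences of the system have modulus $7$, while all other moduli are distinct from each other and from $7$. *)

theory Defs
  imports Main "HOL-Number_Theory.Cong"
begin

(* A pair (r, m) stands for the congruence x = r (mod m).  The residue is taken as the
   canonical representative 0 <= r < m, so that distinct pairs are distinct congruences
   and counting pairs with a given modulus does not count a residue class twice. *)
definition covering_system :: "(int \<times> int) set \<Rightarrow> bool" where
  "covering_system C \<longleftrightarrow>
     finite C \<and>
     (\<forall>(r, m) \<in> C. 0 \<le> r \<and> r < m) \<and>
     (\<forall>x. \<exists>(r, m) \<in> C. [x = r] (mod m))"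

end

theory Submission
  imports Defs "HOL-Number_Theory.Number_Theory"
begin

text \<open>
  Suppose that the part \<open>U\<close> of the integers not yet covered can be covered \<open>k\<close> times over, using
  pairwise disjoint sets of moduli all coprime to a prime \<open>p\<close>. Multiplying the moduli of these
  covers by \<open>p\<^sup>j\<close> for \<open>j \<ge> 1\<close>, one removes from \<open>U\<close> all integers \<open>x = p\<^sup>j\<^sup>-\<^sup>1 u\<close> with \<open>u mod p\<close> in
  \<open>{1..k}\<close>. What survives has \<open>u mod p\<close> in the remaining \<open>s = p - 1 - k\<close> classes, and these can be
  covered another \<open>k div s\<close> times over with the same moduli, each copy serving one class. The
  exponent \<open>j\<close> is bounded; the multiples of \<open>p\<^sup>J\<close> left at the end are covered by
  \<open>q, p q, \<dots>, p\<^sup>J q\<close>, one for each class modulo a fresh prime \<open>q \<le> J + 1\<close>.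

  Starting from the single modulus \<open>1\<close>, so with \<open>k = 1\<close>, the primes 3 and 5 give \<open>k = 2\<close> and
  \<open>k = 3\<close>. The three extra uses of the modulus 7 let the prime 7 remove all six nonzero
  classes at \<open>j = 1\<close>, so that 7 gives \<open>k = 7\<close>. The primes 11, 13, 17, 19, 23 then
  give \<open>k = 9, 12, 15, 20, 30\<close>, and \<open>30 \<ge> 29 - 1\<close> means that nothing survives the prime 29.
\<close>

section \<open>Residue classes and multiple covers\<close>

definition residue_class :: "int \<Rightarrow> int set \<Rightarrow> bool" where
  "residue_class m S \<longleftrightarrow> (\<exists>r. S = {x. [x = r] (mod m)})"

lemma residue_class_cong [simp]: "residue_class m {x. [x = r] (mod m)}"
  by (auto simp: residue_class_def)

lemma residue_class_Int:
  assumes "residue_class m S" "residue_class n T" "coprime m n"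
  shows "residue_class (m * n) (S \<inter> T)"
proof -
  obtain r s where S: "S = {x. [x = r] (mod m)}" and T: "T = {x. [x = s] (mod n)}"
    using assms by (auto simp: residue_class_def)
  obtain z where z: "[z = r] (mod m)" "[z = s] (mod n)"
    using binary_chinese_remainder_int[OF assms(3)] by blast
  have "S \<inter> T = {x. [x = z] (mod m * n)}"
  proof (intro equalityI subsetI)
    fix x assume "x \<in> S \<inter> T"
    then have "[x = z] (mod m)" "[x = z] (mod n)"
      using z by (auto simp: S T intro: cong_trans cong_sym)
    then show "x \<in> {x. [x = z] (mod m * n)}"
      using coprime_cong_mult[OF _ _ assms(3)] by blast
  next
    fix x assume "x \<in> {x. [x = z] (mod m * n)}"
    then have "[x = z] (mod m)" "[x = z] (mod n)"
      using cong_modulus_mult[of x z m n] cong_modulus_mult[of x z n m]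
      by (auto simp: mult.commute)
    then show "x \<in> S \<inter> T"
      using z by (auto simp: S T intro: cong_trans)
  qed
  then show ?thesis by simp
qed

text \<open>
  \<open>D\<close> holds the moduli already spent on \<open>V - U\<close>, and the colour classes of \<open>\<kappa>\<close> on \<open>E\<close> are the
  \<open>k\<close> disjoint sets of moduli covering \<open>U\<close>. The moduli in \<open>E\<close> may recur in \<open>D\<close>, since
  those in \<open>E\<close> are used only after multiplication by a new prime. Coprimality with every \<open>n\<close> coprime
  to \<open>N\<close> says that only primes dividing \<open>N\<close> occur.
\<close>
definition multicover :: "int set \<Rightarrow> int set \<Rightarrow> int \<Rightarrow> nat \<Rightarrow> bool" where
  "multicover V U N k \<longleftrightarrow> U \<subseteq> V \<and>
     (\<exists>D \<rho> E \<sigma> \<kappa>. finite D \<and> finite E \<and>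
        (\<forall>m\<in>D. 1 < m \<and> (\<forall>n. coprime N n \<longrightarrow> coprime m n) \<and> residue_class m (\<rho> m)) \<and>
        (\<forall>m\<in>E. 0 < m \<and> (\<forall>n. coprime N n \<longrightarrow> coprime m n) \<and> residue_class m (\<sigma> m)) \<and>
        V \<subseteq> U \<union> (\<Union>m\<in>D. \<rho> m) \<and>
        (\<forall>x\<in>U. \<forall>i<k. \<exists>m\<in>E. \<kappa> m = i \<and> x \<in> \<sigma> m))"

text \<open>The modulus 1 may stand in \<open>E\<close>, though not in \<open>D\<close>, because it
  is spent only after multiplication by a prime power.\<close>

lemma multicover_initial: "multicover V V 1 1"
proof -
  have "residue_class 1 UNIV" using residue_class_cong[of 1 0] by simp
  then show ?thesis
    unfolding multicover_def
    by (intro conjI exI[of _ "{}"] exI[of _ "{1}"] exI[of _ "\<lambda>_. UNIV"] exI[of _ "\<lambda>_. 0"]) auto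
qed

section \<open>Removing digits at one prime\<close>

text \<open>For prime \<open>p\<close>: the lowest nonzero \<open>p\<close>-adic digit exceeds
  \<open>k\<close> and sits below position \<open>J\<close>. Colour \<open>l\<close> removes digit
  \<open>l + 1\<close>, since digit 0 defers to the next level.\<close>

definition survivors :: "int set \<Rightarrow> int \<Rightarrow> nat \<Rightarrow> nat \<Rightarrow> int set" where
  "survivors U p J k = {x \<in> U. \<not> p ^ J dvd x \<and>
     (\<forall>j\<in>{1..J}. \<forall>l<k. \<not> [x = (int l + 1) * p ^ (j - 1)] (mod p ^ j))}"

text \<open>Each product \<open>e * p ^ j\<close> serves twice: in the spent system with the digit
  of its colour \<open>l\<close>, and in the new multicover with residue \<open>b j l\<close> and
  colour \<open>c j l\<close>. \<open>E\<close> itself still supplies the colours below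
  \<open>k\<close>.\<close>

lemma multicover_tower:
  fixes p q :: int and b :: "nat \<Rightarrow> nat \<Rightarrow> int" and c :: "nat \<Rightarrow> nat \<Rightarrow> nat"
  assumes mc: "multicover V U N k"
    and p: "prime p" "coprime N p"
    and q: "1 < q" "coprime N q" "coprime p q" "q \<le> int J + 1"
    and cover: "\<And>x i. x \<in> survivors U p J k \<Longrightarrow> k \<le> i \<Longrightarrow> i < k' \<Longrightarrow>
      \<exists>j\<in>{1..J}. \<exists>l<k. c j l = i \<and> [x = b j l] (mod p ^ j)"
  shows "multicover V (survivors U p J k) (N * p * q) k'"
proof -
  from mc obtain D \<rho> E \<sigma> \<kappa> where UV: "U \<subseteq> V" and fin: "finite D" "finite E"
    and D': "\<forall>m\<in>D. 1 < m \<and> (\<forall>n. coprime N n \<longrightarrow> coprime m n) \<and> residue_class m (\<rho> m)"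
    and E': "\<forall>m\<in>E. 0 < m \<and> (\<forall>n. coprime N n \<longrightarrow> coprime m n) \<and> residue_class m (\<sigma> m)"
    and V: "V \<subseteq> U \<union> (\<Union>m\<in>D. \<rho> m)"
    and U': "\<forall>x\<in>U. \<forall>i<k. \<exists>m\<in>E. \<kappa> m = i \<and> x \<in> \<sigma> m"
    unfolding multicover_def by (elim conjE exE) (rule that)
  have D: "1 < m" "coprime N n \<Longrightarrow> coprime m n" "residue_class m (\<rho> m)" if "m \<in> D" for m n
    using D' that by auto
  have E: "0 < m" "coprime N n \<Longrightarrow> coprime m n" "residue_class m (\<sigma> m)" if "m \<in> E" for m n
    using E' that by auto
  have U: "\<exists>m\<in>E. \<kappa> m = i \<and> x \<in> \<sigma> m" if "x \<in> U" "i < k" for x i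
    using U' that by blast
  have p1: "1 < p" using p(1) prime_gt_1_int by blast
  define v where "v m = multiplicity p m" for m
  define w where "w m = m div p ^ v m" for m
  \<comment> \<open>A modulus determines its residue: \<open>v\<close> and \<open>w\<close> recover
    \<open>j\<close> and \<open>e\<close> from \<open>e * p ^ j\<close>, and divisibility by
    \<open>q\<close> or \<open>p\<close> tells the kinds of moduli apart.\<close>
  define \<rho>' where "\<rho>' m =
    (if q dvd m then {x. [x = 0] (mod p ^ v m)} \<inter> {x. [x = int (v m)] (mod q)}
     else if p dvd m then \<sigma> (w m) \<inter> {x. [x = (int (\<kappa> (w m)) + 1) * p ^ (v m - 1)] (mod p ^ v m)}
     else \<rho> m)" for m
  define \<sigma>' where "\<sigma>' m =
    (if p dvd m then \<sigma> (w m) \<inter> {x. [x = b (v m) (\<kappa> (w m))] (mod p ^ v m)} else \<sigma> m)" for m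
  define \<kappa>' where "\<kappa>' m = (if p dvd m then c (v m) (\<kappa> (w m)) else \<kappa> m)" for m
  define T where "T = (\<lambda>(e, j). e * p ^ j) ` (E \<times> {1..J})"
  define Q where "Q = (\<lambda>i. p ^ i * q) ` {..J}"
  have ndvd: "\<not> n dvd m" if "coprime m n" "1 < n" for m n :: int
    using that coprime_common_divisor[of m n n] by auto
  have Ep: "\<not> p dvd e" if "e \<in> E" for e
    using ndvd E(2) p p1 that by auto
  have vw: "v (e * p ^ j) = j" "w (e * p ^ j) = e" if "coprime e p" "e \<noteq> 0" for e j
  proof -
    show "v (e * p ^ j) = j"
      using that p(1) ndvd[OF that(1) p1] unfolding v_def
      by (subst prime_elem_multiplicity_mult_distrib)
         (auto simp: multiplicity_prime_power not_dvd_imp_multiplicity_0 multiplicity_same_power)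
    then show "w (e * p ^ j) = e"
      using p1 by (simp add: w_def)
  qed
  have Evw: "v (e * p ^ j) = j" "w (e * p ^ j) = e" if "e \<in> E" for e j
    using vw E(1,2)[OF that] p(2) by auto
  have vQ: "v (p ^ i * q) = i" for i
    using vw(1)[of q i] q by (simp add: mult.commute coprime_commute)
  have Tq: "\<not> q dvd e * p ^ j" if "e \<in> E" for e j
    using ndvd[of "e * p ^ j" q] E(2)[OF that q(2)] q by simp
  have Dp: "\<not> p dvd m" and Dq: "\<not> q dvd m" if "m \<in> D" for m
    using ndvd D(2) p q p1 that by auto
  have \<rho>T: "\<rho>' (e * p ^ j) = \<sigma> e \<inter> {x. [x = (int (\<kappa> e) + 1) * p ^ (j - 1)] (mod p ^ j)}"
    and \<sigma>T: "\<sigma>' (e * p ^ j) = \<sigma> e \<inter> {x. [x = b j (\<kappa> e)] (mod p ^ j)}"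
    and \<kappa>T: "\<kappa>' (e * p ^ j) = c j (\<kappa> e)"
    if "e \<in> E" "j \<in> {1..J}" for e j
    using that Tq Evw by (auto simp: \<rho>'_def \<sigma>'_def \<kappa>'_def dvd_power)
  have \<rho>Q: "\<rho>' (p ^ i * q) = {x. [x = 0] (mod p ^ i)} \<inter> {x. [x = int i] (mod q)}" for i
    by (simp add: \<rho>'_def vQ)
  have Tcop: "coprime (e * p ^ j) n" if "e \<in> E" "coprime (N * p * q) n" for e j n
    using that E(2) by simp
  have Tpos: "0 < e * p ^ j" if "e \<in> E" for e j
    using E(1)[OF that] p1 by simp
  have Tcl: "residue_class (e * p ^ j) (\<sigma> e \<inter> {x. [x = r] (mod p ^ j)})" if "e \<in> E" for e j r
    using that E(2,3) p by (intro residue_class_Int) auto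
  show ?thesis
    unfolding multicover_def
  proof (intro conjI exI)
    show "survivors U p J k \<subseteq> V"
      using UV by (auto simp: survivors_def)
    show "finite (D \<union> T \<union> Q)" "finite (E \<union> T)"
      using fin by (auto simp: T_def Q_def)
    show "\<forall>m\<in>D \<union> T \<union> Q. 1 < m \<and> (\<forall>n. coprime (N * p * q) n \<longrightarrow> coprime m n) \<and>
        residue_class m (\<rho>' m)"
    proof (intro ballI)
      fix m assume "m \<in> D \<union> T \<union> Q"
      then consider "m \<in> D" | "m \<in> T" | "m \<in> Q" by blast
      then show "1 < m \<and> (\<forall>n. coprime (N * p * q) n \<longrightarrow> coprime m n) \<and> residue_class m (\<rho>' m)"
      proof cases
        case 1
        then show ?thesis using D Dp Dq by (auto simp: \<rho>'_def)
      next
        case 2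
        then obtain e j where m: "m = e * p ^ j" "e \<in> E" "j \<in> {1..J}"
          by (auto simp: T_def)
        have "1 < p ^ j" using p1 m(3) by simp
        moreover have "1 \<le> e" using E(1)[OF m(2)] by simp
        ultimately have "1 < e * p ^ j"
          by (smt (verit) mult_less_cancel_right1 mult_le_cancel_right1)
        then show ?thesis
          using m \<rho>T Tcop Tcl by auto
      next
        case 3
        then obtain i where m: "m = p ^ i * q" by (auto simp: Q_def)
        have "1 \<le> p ^ i" using p1 by simp
        then have "1 < p ^ i * q" using q(1)
          by (smt (verit) mult_less_cancel_right1 mult_le_cancel_right1)
        moreover have "residue_class m (\<rho>' m)"
          unfolding m \<rho>Q using q(3) by (intro residue_class_Int) auto
        ultimately show ?thesis using m by auto
      qed
    qed
    show "\<forall>m\<in>E \<union> T. 0 < m \<and> (\<forall>n. coprime (N * p * q) n \<longrightarrow> coprime m n) \<and>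
        residue_class m (\<sigma>' m)"
    proof (intro ballI)
      fix m assume "m \<in> E \<union> T"
      then consider "m \<in> E" | "m \<in> T" by blast
      then show "0 < m \<and> (\<forall>n. coprime (N * p * q) n \<longrightarrow> coprime m n) \<and> residue_class m (\<sigma>' m)"
      proof cases
        case 1
        then show ?thesis using E Ep by (auto simp: \<sigma>'_def)
      next
        case 2
        then obtain e j where "m = e * p ^ j" "e \<in> E" "j \<in> {1..J}"
          by (auto simp: T_def)
        then show ?thesis
          using \<sigma>T Tcop Tcl Tpos by auto
      qed
    qed
    show "V \<subseteq> survivors U p J k \<union> (\<Union>m\<in>D \<union> T \<union> Q. \<rho>' m)"
    proof
      fix x assume "x \<in> V"
      then consider m where "m \<in> D" "x \<in> \<rho> m" | "x \<in> U" "p ^ J dvd x"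
        | j l where "x \<in> U" "j \<in> {1..J}" "l < k" "[x = (int l + 1) * p ^ (j - 1)] (mod p ^ j)"
        | "x \<in> survivors U p J k"
        using V unfolding survivors_def by blast
      then show "x \<in> survivors U p J k \<union> (\<Union>m\<in>D \<union> T \<union> Q. \<rho>' m)"
      proof cases
        case 1
        then show ?thesis using Dp Dq by (auto simp: \<rho>'_def)
      next
        case 2
        \<comment> \<open>The class of \<open>x\<close> modulo \<open>q\<close> selects the modulus
          \<open>p ^ i * q\<close>; as \<open>i\<close> is at most \<open>q - 1\<close>, hence at
          most \<open>J\<close>, \<open>p ^ i\<close> divides \<open>x\<close>.\<close>
        define i where "i = nat (x mod q)"
        have i: "int i = x mod q" using q(1) by (simp add: i_def)
        have "int i < q" using q(1) by (simp add: i)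
        then have "i \<le> J" using q(4) by linarith
        then have "p ^ i dvd x" using 2 le_imp_power_dvd dvd_trans by blast
        then have "x \<in> \<rho>' (p ^ i * q)"
          by (simp add: \<rho>Q i cong_0_iff)
        then show ?thesis using \<open>i \<le> J\<close> by (auto simp: Q_def)
      next
        case 3
        then obtain e where e: "e \<in> E" "\<kappa> e = l" "x \<in> \<sigma> e" using U by blast
        then have "x \<in> \<rho>' (e * p ^ j)" using 3 \<rho>T by auto
        moreover have "e * p ^ j \<in> T" using e 3 by (auto simp: T_def)
        ultimately show ?thesis by blast
      qed blast
    qed
    show "\<forall>x\<in>survivors U p J k. \<forall>i<k'. \<exists>m\<in>E \<union> T. \<kappa>' m = i \<and> x \<in> \<sigma>' m"
    proof (intro ballI allI impI)
      fix x i assume x: "x \<in> survivors U p J k" and i: "i < k'"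
      have xU: "x \<in> U" using x by (simp add: survivors_def)
      show "\<exists>m\<in>E \<union> T. \<kappa>' m = i \<and> x \<in> \<sigma>' m"
      proof (cases "i < k")
        case True
        then obtain m where "m \<in> E" "\<kappa> m = i" "x \<in> \<sigma> m" using U xU by blast
        then show ?thesis using Ep by (auto simp: \<kappa>'_def \<sigma>'_def)
      next
        case False
        then obtain j l where jl: "j \<in> {1..J}" "l < k" "c j l = i" "[x = b j l] (mod p ^ j)"
          using cover[OF x _ i] by auto
        then obtain e where e: "e \<in> E" "\<kappa> e = l" "x \<in> \<sigma> e" using U xU by blast
        then have "e * p ^ j \<in> T" "\<kappa>' (e * p ^ j) = i" "x \<in> \<sigma>' (e * p ^ j)"
          using jl \<sigma>T \<kappa>T by (auto simp: T_def)
        then show ?thesis by blast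
      qed
    qed
  qed
qed

text \<open>Divide out the largest power of \<open>p\<close>: the quotient modulo \<open>p\<close>
  is a nonzero digit, and survival rules out the digits up to \<open>k\<close>.\<close>

lemma survivors_digit:
  assumes x: "x \<in> survivors U p J k" and p: "1 < p"
  obtains j a where "j \<in> {1..J}" "k < a" "int a < p" "[x = int a * p ^ (j - 1)] (mod p ^ j)"
proof -
  have nd: "\<not> p ^ J dvd x" using x by (simp add: survivors_def)
  obtain i where i: "p ^ i dvd x" "\<not> p ^ Suc i dvd x" "i < J"
  proof -
    define j where "j = (LEAST j. \<not> p ^ j dvd x)"
    have j: "\<not> p ^ j dvd x" "j \<le> J"
      unfolding j_def using nd LeastI[of "\<lambda>j. \<not> p ^ j dvd x" J] Least_le[of "\<lambda>j. \<not> p ^ j dvd x" J]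
      by auto
    then obtain i where ji: "j = Suc i" by (cases j) auto
    then have "p ^ i dvd x"
      using not_less_Least[of i "\<lambda>j. \<not> p ^ j dvd x"] by (simp add: j_def)
    then show ?thesis using that j ji by auto
  qed
  then obtain u where u: "x = p ^ i * u" by blast
  have "\<not> p dvd u" using i(2) u by auto
  define a where "a = nat (u mod p)"
  have a: "int a = u mod p" using p by (simp add: a_def)
  have "[u = int a] (mod p)" by (simp add: a)
  then have c: "[x = int a * p ^ (Suc i - 1)] (mod p ^ Suc i)"
    unfolding u cong_iff_dvd_diff
    by (simp add: mult.commute[of "int a"] flip: right_diff_distrib)
  have "0 < a" using \<open>\<not> p dvd u\<close> a by (metis dvd_eq_mod_eq_0 gr0I of_nat_0)
  have "k < a"
  proof (rule ccontr)
    assume "\<not> k < a"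
    then have "a - 1 < k" using \<open>0 < a\<close> by simp
    moreover have "int (a - 1) + 1 = int a" using \<open>0 < a\<close> by simp
    ultimately show False
      using x c i(3) unfolding survivors_def by (auto dest!: bspec[of _ _ "Suc i"])
  qed
  moreover have "int a < p" using p by (simp add: a)
  ultimately show ?thesis using that[of "Suc i" a] c i(3) by auto
qed

section \<open>Raising the number of covers\<close>

lemma multicover_step:
  assumes mc: "\<exists>U. multicover V U N k"
    and p: "prime (int p)" "coprime N (int p)"
    and q: "1 < q" "coprime N (int q)" "coprime p q"
    and count: "p = k + 1 + s" "0 < s" "g * s \<le> k"
    and result: "N' = N * int p * int q" "k' = k + g"
  shows "\<exists>U. multicover V U N' k'"
proof -
  obtain U where U: "multicover V U N k" using mc by blast
  have p1: "1 < int p" using p(1) prime_gt_1_int by blast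
  \<comment> \<open>With \<open>l = h * s + t\<close>, old colour \<open>l\<close> covers the
    surviving digit \<open>k + 1 + t\<close> for new colour \<open>k + h\<close>;
    \<open>g * s \<le> k\<close> supplies enough old colours.\<close>
  have "multicover V (survivors U (int p) q k) (N * int p * int q) (k + g)"
  proof (rule multicover_tower[OF U p, where c = "\<lambda>j l. k + l div s" and
        b = "\<lambda>j l. int (k + 1 + l mod s) * int p ^ (j - 1)"])
    fix x i assume x: "x \<in> survivors U (int p) q k" and i: "k \<le> i" "i < k + g"
    obtain j a where ja: "j \<in> {1..q}" "k < a" "int a < int p"
        "[x = int a * int p ^ (j - 1)] (mod int p ^ j)"
      using survivors_digit[OF x p1] by metis
    define t where "t = a - (k + 1)"
    have t: "a = k + 1 + t" "t < s" using ja count by (auto simp: t_def)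
    have "(i - k) * s + t < (i - k + 1) * s" using t by simp
    also have "\<dots> \<le> g * s" using i by (intro mult_right_mono) auto
    finally have "(i - k) * s + t < k" using count by simp
    moreover have "k + ((i - k) * s + t) div s = i" "((i - k) * s + t) mod s = t"
      using t i by auto
    ultimately show "\<exists>j\<in>{1..q}. \<exists>l<k. k + l div s = i \<and>
        [x = int (k + 1 + l mod s) * int p ^ (j - 1)] (mod int p ^ j)"
      using ja t by metis
  qed (use q in \<open>auto simp: coprime_int_iff\<close>)
  then show ?thesis unfolding result by blast
qed

text \<open>
  The extra congruences cover the classes 4, 5, 6 modulo 7, so all survivors are multiples of 7. Hence
  the three covers multiplied by 7 itself remain covers, and the levels \<open>j \<ge> 2\<close> provide one
  more, as in the general step.
\<close>
lemma multicover_seven: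
  assumes mc: "\<exists>U. multicover {x. x mod 7 < 4} U N 3"
    and N: "coprime N 7"
    and q: "1 < q" "coprime N (int q)" "coprime 7 q"
    and result: "N' = N * 7 * int q"
  shows "\<exists>U. multicover {x. x mod 7 < 4} U N' 7"
proof -
  obtain U where U: "multicover {x. x mod 7 < 4} U N 3" using mc by blast
  \<comment> \<open>At level 1 the three old colours become 3, 4, 5, all on residue 0; at higher
    levels they serve the digits 4, 5, 6 for the new colour 6.\<close>
  have "multicover {x. x mod 7 < 4} (survivors U 7 q 3) (N * 7 * int q) 7"
  proof (rule multicover_tower[OF U _ N, where c = "\<lambda>j l. if j = 1 then 3 + l else 6" and
        b = "\<lambda>j l. if j = 1 then 0 else int (4 + l) * 7 ^ (j - 1)"])
    fix x i assume x: "x \<in> survivors U 7 q 3" and i: "3 \<le> i" "i < (7::nat)"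
    obtain j a where ja: "j \<in> {1..q}" "3 < a" "int a < 7" "[x = int a * 7 ^ (j - 1)] (mod 7 ^ j)"
      using survivors_digit[OF x] by (metis one_less_numeral_iff semiring_norm(77))
    have "x mod 7 < 4"
      using x U by (auto simp: survivors_def multicover_def)
    then have j1: "j \<noteq> 1"
      using ja by (auto simp: cong_def)
    then have "(7::int) dvd 7 ^ (j - 1)" "(7::int) dvd 7 ^ j" using ja by (auto simp: dvd_power)
    then have x7: "[x = 0] (mod 7)"
      using ja(4) by (meson cong_0_iff cong_dvd_iff cong_dvd_modulus dvd_mult)
    show "\<exists>j\<in>{1..q}. \<exists>l<3. (if j = 1 then 3 + l else 6) = i \<and>
        [x = (if j = 1 then 0 else int (4 + l) * 7 ^ (j - 1))] (mod 7 ^ j)"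
    proof (cases "i = 6")
      case True
      then show ?thesis using ja j1
        by (intro bexI[of _ j] exI[of _ "a - 4"]) auto
    next
      case False
      then show ?thesis using i x7 q(1)
        by (intro bexI[of _ 1] exI[of _ "i - 3"]) auto
    qed
  qed (use q in \<open>auto simp: coprime_int_iff[of 7 q, simplified]\<close>)
  then show ?thesis unfolding result by blast
qed

text \<open>No digit lies strictly between \<open>k\<close> and \<open>p\<close>, so nothing
  survives.\<close>

lemma multicover_finish:
  assumes mc: "\<exists>U. multicover V U N k"
    and p: "prime (int p)" "coprime N (int p)" "p \<le> k + 1"
    and q: "1 < q" "coprime N (int q)" "coprime p q"
    and result: "N' = N * int p * int q"
  shows "multicover V {} N' 0"
proof -
  obtain U where U: "multicover V U N k" using mc by blast
  have p1: "1 < int p" using p(1) prime_gt_1_int by blast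
  have "survivors U (int p) q k = {}"
    using survivors_digit[OF _ p1, of _ U q k] p(3) by (metis all_not_in_conv add.commute
        less_eq_Suc_le not_less of_nat_less_iff order.trans plus_1_eq_Suc)
  then show ?thesis
    using multicover_tower[OF U p(1,2), of "int q" q 0] q result by (auto simp: coprime_int_iff)
qed

section \<open>Choice of primes and the final system\<close>

lemma residue_covering:
  "\<exists>D r. finite D \<and> (\<forall>m\<in>D. 1 < m \<and> odd m \<and> 0 \<le> r m \<and> r m < m) \<and>
     (\<forall>x::int. x mod 7 < 4 \<longrightarrow> (\<exists>m\<in>D. [x = r m] (mod m)))"
proof -
  let ?V = "{x::int. x mod 7 < 4}"
  note arith = coprime_iff_gcd_eq_1 gcd_non_0_int gcd_non_0_nat
  \<comment> \<open>The third argument is the product of all \<open>p\<close> and \<open>q\<close> used so far.\<close>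
  have "\<exists>U. multicover ?V U 1 1"
    using multicover_initial by blast
  then have "\<exists>U. multicover ?V U 93 2"
    \<comment> \<open>Throughout, \<open>s = p - 1 - k\<close> and \<open>g = k div s\<close>. Each
      \<open>q\<close> is a new prime above 29, so it never meets a later \<open>p\<close>.\<close>
    by (rule multicover_step[where p = 3 and q = 31 and s = 1 and g = 1]) (simp_all add: arith)
  then have "\<exists>U. multicover ?V U 17205 3"
    by (rule multicover_step[where p = 5 and q = 37 and s = 2 and g = 1]) (simp_all add: arith)
  then have "\<exists>U. multicover ?V U 4937835 7"
    by (rule multicover_seven[where q = 41]) (simp_all add: arith)
  then have "\<exists>U. multicover ?V U 2335595955 9"
    by (rule multicover_step[where p = 11 and q = 43 and s = 3 and g = 2]) (simp_all add: arith)
  then have "\<exists>U. multicover ?V U 1427049128505 12"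
    by (rule multicover_step[where p = 13 and q = 47 and s = 3 and g = 3]) (simp_all add: arith)
  then have "\<exists>U. multicover ?V U 1285771264783005 15"
    by (rule multicover_step[where p = 17 and q = 53 and s = 4 and g = 3]) (simp_all add: arith)
  then have "\<exists>U. multicover ?V U 1441349587821748605 20"
    by (rule multicover_step[where p = 19 and q = 59 and s = 3 and g = 5]) (simp_all add: arith)
  then have "\<exists>U. multicover ?V U 2022213471713913292815 30"
    by (rule multicover_step[where p = 23 and q = 61 and s = 2 and g = 10]) (simp_all add: arith)
  then have "multicover ?V {} 3929160775540133527939545 0"
    by (rule multicover_finish[where p = 29 and q = 67]) (simp_all add: arith)
  then obtain D \<rho> where fin: "finite D" and V: "?V \<subseteq> (\<Union>m\<in>D. \<rho> m)"
    and D: "\<forall>m\<in>D. 1 < m \<and> (\<forall>n. coprime (3929160775540133527939545::int) n \<longrightarrow> coprime m n) \<and>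
      residue_class m (\<rho> m)"
    unfolding multicover_def by (elim conjE exE) (rule that, simp_all)
  then obtain r where r: "\<rho> m = {x. [x = r m] (mod m)}" if "m \<in> D" for m
    unfolding residue_class_def by metis
  have D12: "1 < m" "odd m" if "m \<in> D" for m
  proof -
    have "coprime (3929160775540133527939545::int) 2" by (simp add: arith)
    then have "coprime m 2" using D that by blast
    then show "1 < m" "odd m" using D that by auto
  qed
  show ?thesis
  proof (intro exI conjI)
    show "\<forall>m\<in>D. 1 < m \<and> odd m \<and> 0 \<le> r m mod m \<and> r m mod m < m"
    proof
      fix m assume "m \<in> D"
      then show "1 < m \<and> odd m \<and> 0 \<le> r m mod m \<and> r m mod m < m"
        using D12[of m] by simp
    qed
    show "\<forall>x::int. x mod 7 < 4 \<longrightarrow> (\<exists>m\<in>D. [x = r m mod m] (mod m))"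
      using V r by auto
  qed (fact fin)
qed

theorem theorem4p1:
  "\<exists>C. covering_system C \<and>
       (\<forall>(r, m) \<in> C. odd m \<and> m > 1) \<and>
       card {c \<in> C. snd c = 7} = 4 \<and>
       inj_on snd {c \<in> C. snd c \<noteq> 7}"
proof -
  obtain D and r :: "int \<Rightarrow> int" where D: "finite D"
      "\<And>m. m \<in> D \<Longrightarrow> 1 < m \<and> odd m \<and> 0 \<le> r m \<and> r m < m"
      "\<And>x. x mod 7 < 4 \<Longrightarrow> \<exists>m\<in>D. [x = r m] (mod m)"
    using residue_covering by blast
  \<comment> \<open>If 7 lies in \<open>D\<close>, its congruence becomes the fourth with modulus 7.
    If 7 is absent or its residue is at least 4, it covers no \<open>x\<close> with
    \<open>x mod 7 < 4\<close>, and the default 0 keeps the four pairs distinct.\<close>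
  define a where "a = (if 7 \<in> D \<and> r 7 < 4 then r 7 else 0)"
  have a: "0 \<le> a" "a < 4" using D(2)[of 7] by (auto simp: a_def)
  define S :: "(int \<times> int) set" where "S = {(a, 7), (4, 7), (5, 7), (6, 7)}"
  define C where "C = (\<lambda>m. (r m, m)) ` (D - {7}) \<union> S"
  have "{c \<in> C. snd c = 7} = S" "{c \<in> C. snd c \<noteq> 7} = (\<lambda>m. (r m, m)) ` (D - {7})"
    by (auto simp: C_def S_def)
  then have "card {c \<in> C. snd c = 7} = 4" "inj_on snd {c \<in> C. snd c \<noteq> 7}"
    using a by (auto simp: S_def inj_on_def)
  moreover have "\<exists>(r, m)\<in>C. [x = r] (mod m)" for x
  proof (cases "x mod 7 < 4")
    case False
    then have "x mod 7 \<in> {4, 5, 6}" using pos_mod_bound[of 7 x] by auto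
    then show ?thesis by (auto simp: C_def S_def cong_def)
  next
    case True
    then obtain m where m: "m \<in> D" "[x = r m] (mod m)" using D(3) by blast
    show ?thesis
    proof (cases "m = 7")
      case False
      then show ?thesis using m by (auto simp: C_def)
    next
      case m7: True
      then have "x mod 7 = r 7" using m D(2)[of 7] by (simp add: cong_def)
      then have "[x = a] (mod 7)" using True m m7 by (simp add: a_def cong_def)
      then show ?thesis by (auto simp: C_def S_def)
    qed
  qed
  moreover have "finite C" "\<forall>(r, m)\<in>C. 0 \<le> r \<and> r < m" "\<forall>(r, m)\<in>C. odd m \<and> m > 1"
    using D(1,2) a by (auto simp: C_def S_def)
  ultimately show ?thesis unfolding covering_system_def by blast
qed

end
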